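(* Let $R$ be a commutative ring with unity and let $M$ be an $R$-module with $\operatorname{Spec}(M)\neq\emptyset$. Then $\widetilde{\operatorname{Spec}(M)}$ is a compact space if and only if $\widetilde{\operatorname{Spec}(M)}=\bigcup_{i=1}^{n}\widetilde{D}(R-(P_i:M))$ for some finite collection $\{P_i\}_{i=1}^{n}$ of prime submodules of $M$.
   Context: For a submodule $N$ of an $R$-module $M$, $(N:M)=\{r\in R : rM\subseteq N\}$. A proper submodule $P$ of $M$ is prime if whenever $rm\in P$ with $r\in R$, $m\in M$, then $m\in P$ or $r\in(P:M)$; in this case $(P:M)$ is a prime ideal of $R$. $\operatorname{Spec}(M)$ is the set of all prime submodules of $M$. A subset $T\subseteq R$ is multiplicatively closed if $1\in T$ and $xy\in T$ whenever $x,y\in T$. For a family $\mathcal{S}=\{S_i\}_{i\in I}$ of multiplicatively closed subsets of $R$, $\widetilde{V}(\mathcal{S})=\{P\in\operatorname{Spec}(M) \mid (P:M)\cap S_i\neq\emptyset \text{ for all } i\in I\}$. $\widetilde{\operatorname{Spec}(M)}$ denotes the set $\operatorname{Spec}(M)$ with the topology whose closed sets are exactly the sets $\widetilde{V}(\mathcal{S})$, $\mathcal{S}$ ranging over all families of multiplicatively closed subsets of $R$. For a multiplicatively closed subset $T$ of $R$, $\widetilde{D}(T)=\{P\in\operatorname{Spec}(M) \mid (P:M)\cap T=\emptyset\}$, an open set; $R-(P:M)$ is the set complement of $(P:M)$ in $R$. Compact means quasi-compact: every open cover has a finite subcover (no Hausdorff condition). *)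

theory Defs
  imports "HOL-Algebra.Module" "HOL-Analysis.Abstract_Topology"
begin

definition colon_module ::
  "('a, 'b) ring_scheme \<Rightarrow> ('a, 'c, 'd) module_scheme \<Rightarrow> 'c set \<Rightarrow> 'a set" where
  "colon_module R M N = {r \<in> carrier R. \<forall>m \<in> carrier M. r \<odot>\<^bsub>M\<^esub> m \<in> N}"

definition prime_submodule ::
  "('a, 'b) ring_scheme \<Rightarrow> ('a, 'c, 'd) module_scheme \<Rightarrow> 'c set \<Rightarrow> bool" where
  "prime_submodule R M P \<longleftrightarrow> submodule P R M \<and> P \<noteq> carrier M \<and>
     (\<forall>r \<in> carrier R. \<forall>m \<in> carrier M.
        r \<odot>\<^bsub>M\<^esub> m \<in> P \<longrightarrow> m \<in> P \<or> r \<in> colon_module R M P)"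

definition Spec_module ::
  "('a, 'b) ring_scheme \<Rightarrow> ('a, 'c, 'd) module_scheme \<Rightarrow> 'c set set" where
  "Spec_module R M = {P. prime_submodule R M P}"

text \<open>A multiplicatively closed subset is a \<^const>\<open>submonoid\<close> of the multiplicative monoid of \<open>R\<close>.
  Only the set of members of a family matters below, so a family is represented by a set of subsets
  (possibly empty).\<close>

definition V_tilde ::
  "('a, 'b) ring_scheme \<Rightarrow> ('a, 'c, 'd) module_scheme \<Rightarrow> 'a set set \<Rightarrow> 'c set set" where
  "V_tilde R M \<S> = {P \<in> Spec_module R M. \<forall>S \<in> \<S>. colon_module R M P \<inter> S \<noteq> {}}"

definition D_tilde ::
  "('a, 'b) ring_scheme \<Rightarrow> ('a, 'c, 'd) module_scheme \<Rightarrow> 'a set \<Rightarrow> 'c set set" where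
  "D_tilde R M T = {P \<in> Spec_module R M. colon_module R M P \<inter> T = {}}"

definition Spec_tilde ::
  "('a, 'b) ring_scheme \<Rightarrow> ('a, 'c, 'd) module_scheme \<Rightarrow> 'c set topology" where
  "Spec_tilde R M = topology (\<lambda>U. U \<subseteq> Spec_module R M \<and>
     (\<exists>\<S>. (\<forall>S \<in> \<S>. submonoid S R) \<and> Spec_module R M - U = V_tilde R M \<S>))"

text \<open>The function \<^const>\<open>topology\<close> is unspecified outside \<^const>\<open>istopology\<close>. The facts below show
  that the sets in question do form a topology, with the intended closed sets.\<close>

lemma submonoid_compl_colon:
  assumes "Module.module R M" and P: "P \<in> Spec_module R M"
  shows "submonoid (carrier R - colon_module R M P) R"
proof -
  interpret Module.module R M by fact
  have sub: "submodule P R M" and ne: "P \<noteq> carrier M"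
    and pr: "\<And>r m. r \<in> carrier R \<Longrightarrow> m \<in> carrier M \<Longrightarrow> r \<odot>\<^bsub>M\<^esub> m \<in> P \<Longrightarrow>
               m \<in> P \<or> r \<in> colon_module R M P"
    using P by (auto simp: Spec_module_def prime_submodule_def)
  have PM: "P \<subseteq> carrier M"
    using submoduleE(1)[OF sub] .
  show ?thesis
  proof
    show "carrier R - colon_module R M P \<subseteq> carrier R" by auto
    show "\<one>\<^bsub>R\<^esub> \<in> carrier R - colon_module R M P"
      using ne PM by (auto simp: colon_module_def)
    fix x y
    assume x: "x \<in> carrier R - colon_module R M P" and y: "y \<in> carrier R - colon_module R M P"
    have "x \<otimes>\<^bsub>R\<^esub> y \<notin> colon_module R M P"
    proof
      assume "x \<otimes>\<^bsub>R\<^esub> y \<in> colon_module R M P"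
      then have *: "x \<odot>\<^bsub>M\<^esub> (y \<odot>\<^bsub>M\<^esub> m) \<in> P" if "m \<in> carrier M" for m
        using that x y by (auto simp: colon_module_def smult_assoc1)
      have "y \<odot>\<^bsub>M\<^esub> m \<in> P" if "m \<in> carrier M" for m
        using pr[of x "y \<odot>\<^bsub>M\<^esub> m"] *[OF that] that x y by auto
      then show False
        using y by (auto simp: colon_module_def)
    qed
    then show "x \<otimes>\<^bsub>R\<^esub> y \<in> carrier R - colon_module R M P"
      using x y by auto
  qed
qed

lemma closed_Spec_tilde_iff:
  assumes "Module.module R M" and U: "U \<subseteq> Spec_module R M"
  shows "(\<exists>\<S>. (\<forall>S \<in> \<S>. submonoid S R) \<and> Spec_module R M - U = V_tilde R M \<S>) \<longleftrightarrow>
     (\<forall>P \<in> U. \<forall>Q \<in> Spec_module R M. colon_module R M Q \<subseteq> colon_module R M P \<longrightarrow> Q \<in> U)"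
    (is "?L \<longleftrightarrow> ?A")
proof
  assume ?L
  then obtain \<S> where \<S>: "Spec_module R M - U = V_tilde R M \<S>" by blast
  show ?A
  proof (intro ballI impI)
    fix P Q
    assume P: "P \<in> U" and Q: "Q \<in> Spec_module R M"
      and sub: "colon_module R M Q \<subseteq> colon_module R M P"
    from P U \<S> have "P \<notin> V_tilde R M \<S>" "P \<in> Spec_module R M" by auto
    then have "Q \<notin> V_tilde R M \<S>"
      using sub unfolding V_tilde_def by blast
    then show "Q \<in> U" using Q \<S> by blast
  qed
next
  assume A: ?A
  let ?\<S> = "(\<lambda>P. carrier R - colon_module R M P) ` U"
  have carr: "colon_module R M Q \<subseteq> carrier R" for Q
    by (auto simp: colon_module_def)
  have "Spec_module R M - U = V_tilde R M ?\<S>"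
  proof (intro Set.set_eqI iffI)
    fix Q
    assume Q: "Q \<in> Spec_module R M - U"
    have "colon_module R M Q \<inter> (carrier R - colon_module R M P) \<noteq> {}" if "P \<in> U" for P
      using A Q that carr[of Q] by blast
    then show "Q \<in> V_tilde R M ?\<S>"
      using Q by (simp add: V_tilde_def)
  next
    fix Q
    assume Q: "Q \<in> V_tilde R M ?\<S>"
    then have "Q \<notin> U"
      unfolding V_tilde_def by blast
    then show "Q \<in> Spec_module R M - U"
      using Q by (simp add: V_tilde_def)
  qed
  moreover have "\<forall>S \<in> ?\<S>. submonoid S R"
    using submonoid_compl_colon[OF assms(1)] U by auto
  ultimately show ?L by blast
qed

lemma istopology_Spec_tilde:
  assumes "Module.module R M"
  shows "istopology (\<lambda>U. U \<subseteq> Spec_module R M \<and>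
     (\<exists>\<S>. (\<forall>S \<in> \<S>. submonoid S R) \<and> Spec_module R M - U = V_tilde R M \<S>))"
proof -
  have "(\<lambda>U. U \<subseteq> Spec_module R M \<and>
          (\<exists>\<S>. (\<forall>S \<in> \<S>. submonoid S R) \<and> Spec_module R M - U = V_tilde R M \<S>)) =
        (\<lambda>U. U \<subseteq> Spec_module R M \<and>
          (\<forall>P \<in> U. \<forall>Q \<in> Spec_module R M.
             colon_module R M Q \<subseteq> colon_module R M P \<longrightarrow> Q \<in> U))"
    by (intro ext conj_cong refl closed_Spec_tilde_iff[OF assms])
  moreover have "istopology \<dots>"
    unfolding istopology_def
  proof (intro conjI allI impI, goal_cases)
    case (1 S T)
    then show ?case by blast
  next
    case (2 S T)
    then show ?case by blast
  next
    case (3 K)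
    then show ?case by blast
  next
    case (4 K)
    then show ?case by blast
  qed
  ultimately show ?thesis by (simp only:)
qed

lemma openin_Spec_tilde:
  assumes "Module.module R M"
  shows "openin (Spec_tilde R M) U \<longleftrightarrow> U \<subseteq> Spec_module R M \<and>
     (\<exists>\<S>. (\<forall>S \<in> \<S>. submonoid S R) \<and> Spec_module R M - U = V_tilde R M \<S>)"
  unfolding Spec_tilde_def topology_inverse'[OF istopology_Spec_tilde[OF assms]] ..

lemma topspace_Spec_tilde:
  assumes "Module.module R M"
  shows "topspace (Spec_tilde R M) = Spec_module R M"
proof
  show "topspace (Spec_tilde R M) \<subseteq> Spec_module R M"
    by (auto simp: topspace_def openin_Spec_tilde[OF assms])
  have "openin (Spec_tilde R M) (Spec_module R M)"
    unfolding openin_Spec_tilde[OF assms]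
    using closed_Spec_tilde_iff[OF assms subset_refl] by blast
  then show "Spec_module R M \<subseteq> topspace (Spec_tilde R M)"
    by (rule openin_subset)
qed

lemma closedin_Spec_tilde:
  assumes "Module.module R M"
  shows "closedin (Spec_tilde R M) C \<longleftrightarrow>
     (\<exists>\<S>. (\<forall>S \<in> \<S>. submonoid S R) \<and> C = V_tilde R M \<S>)"
proof -
  have "V_tilde R M \<S> \<subseteq> Spec_module R M" for \<S>
    by (auto simp: V_tilde_def)
  then show ?thesis
    unfolding closedin_def topspace_Spec_tilde[OF assms] openin_Spec_tilde[OF assms]
    by (metis Diff_subset double_diff subset_refl)
qed

end

(* The open sets are exactly the sets of primes closed under passing to a smaller colon ideal, so
   D_tilde (R - (P : M)) is the smallest open neighbourhood of P. In any space with smallest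
   neighbourhoods, compactness means that finitely many of them cover. *)
theory Submission
  imports Defs
begin

lemma openin_Spec_tilde_iff_down_closed:
  assumes "Module.module R M"
  shows "openin (Spec_tilde R M) U \<longleftrightarrow> U \<subseteq> Spec_module R M \<and>
     (\<forall>P \<in> U. \<forall>Q \<in> Spec_module R M. colon_module R M Q \<subseteq> colon_module R M P \<longrightarrow> Q \<in> U)"
  unfolding openin_Spec_tilde[OF assms] using closed_Spec_tilde_iff[OF assms] by (rule conj_cong[OF refl])

text \<open>A colon set lies in \<open>carrier R\<close>, so missing the complement of another colon
  set means being contained in it. Neither this nor the form of the right-hand side requires
  \<open>P\<close> to be prime.\<close>

lemma D_tilde_compl_colon:
  "D_tilde R M (carrier R - colon_module R M P) =
     {Q \<in> Spec_module R M. colon_module R M Q \<subseteq> colon_module R M P}"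
  unfolding D_tilde_def colon_module_def by blast

text \<open>Forwards, the sets \<open>N x\<close> are themselves an open cover. Backwards, any open
  set around a centre \<open>p i\<close> swallows all of \<open>N (p i)\<close>, so a cover needs
  only one member per centre.\<close>

lemma compact_space_iff_smallest_neighbourhoods:
  assumes op: "\<And>x. x \<in> topspace X \<Longrightarrow> openin X (N x)"
    and mem: "\<And>x. x \<in> topspace X \<Longrightarrow> x \<in> N x"
    and least: "\<And>x U. openin X U \<Longrightarrow> x \<in> U \<Longrightarrow> N x \<subseteq> U"
  shows "compact_space X \<longleftrightarrow>
    (\<exists>(n::nat) p. (\<forall>i \<in> {1..n}. p i \<in> topspace X) \<and> topspace X = (\<Union>i \<in> {1..n}. N (p i)))"
    (is "_ \<longleftrightarrow> ?F")
proof
  assume compact: "compact_space X"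
  have "topspace X \<subseteq> \<Union> (N ` topspace X)" "\<forall>U \<in> N ` topspace X. openin X U"
    using mem op by auto
  then obtain \<F> where "finite \<F>" "\<F> \<subseteq> N ` topspace X" and cov: "topspace X \<subseteq> \<Union>\<F>"
    using compact[unfolded compact_space_alt, rule_format, of "N ` topspace X"] by auto
  then obtain A where A: "A \<subseteq> topspace X" "finite A" "\<F> = N ` A"
    by (meson finite_subset_image)
  \<comment> \<open>The finite set \<open>A\<close> of centres is listed as \<open>p 1\<close>, ...,
    \<open>p n\<close>; an empty \<open>A\<close> gives \<open>n = 0\<close>.\<close>
  then obtain n :: nat and p where p: "p ` {1..n} = A"
    using ex_bij_betw_nat_finite_1[of A] by (auto simp: bij_betw_def)
  then have p_in: "\<forall>i \<in> {1..n}. p i \<in> topspace X"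
    using A(1) by auto
  moreover have "topspace X = (\<Union>i \<in> {1..n}. N (p i))"
  proof
    show "topspace X \<subseteq> (\<Union>i \<in> {1..n}. N (p i))"
      using cov A(3) p by auto
    show "(\<Union>i \<in> {1..n}. N (p i)) \<subseteq> topspace X"
      using p_in openin_subset[OF op] by (intro UN_least) blast
  qed
  ultimately show ?F
    by (intro exI conjI)
next
  assume ?F
  then obtain n :: nat and p where p: "\<And>i. i \<in> {1..n} \<Longrightarrow> p i \<in> topspace X"
    and cov: "topspace X = (\<Union>i \<in> {1..n}. N (p i))"
    by blast
  show "compact_space X"
    unfolding compact_space_alt
  proof (intro allI impI)
    fix \<U>
    assume "(\<forall>U \<in> \<U>. openin X U) \<and> topspace X \<subseteq> \<Union>\<U>"
    then have \<U>: "\<forall>U \<in> \<U>. openin X U" and "topspace X \<subseteq> \<Union>\<U>"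
      by blast+
    then have "\<forall>i \<in> {1..n}. \<exists>U \<in> \<U>. p i \<in> U"
      using p by blast
    then obtain u where u: "\<And>i. i \<in> {1..n} \<Longrightarrow> u i \<in> \<U> \<and> p i \<in> u i"
      by metis
    \<comment> \<open>Minimality of \<open>N (p i)\<close> turns covering the single point
      \<open>p i\<close> into covering its whole neighbourhood.\<close>
    then have "N (p i) \<subseteq> u i" if "i \<in> {1..n}" for i
      using least \<U> that by blast
    then have "topspace X \<subseteq> \<Union> (u ` {1..n})"
      unfolding cov by blast
    then show "\<exists>\<F>. finite \<F> \<and> \<F> \<subseteq> \<U> \<and> topspace X \<subseteq> \<Union>\<F>"
      using u by (intro exI[of _ "u ` {1..n}"]) auto
  qed
qed

theorem corollary4:
  fixes R :: "('a, 'b) ring_scheme" and M :: "('a, 'c, 'd) module_scheme"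
  assumes "cring R" and "Module.module R M"
    and "Spec_module R M \<noteq> {}"
  shows "compact_space (Spec_tilde R M) \<longleftrightarrow>
    (\<exists>(n::nat) P. (\<forall>i \<in> {1..n}. prime_submodule R M (P i)) \<and>
       topspace (Spec_tilde R M) =
         (\<Union>i \<in> {1..n}. D_tilde R M (carrier R - colon_module R M (P i))))"
proof -
  let ?X = "Spec_tilde R M"
  let ?N = "\<lambda>P. D_tilde R M (carrier R - colon_module R M P)"
  note top = topspace_Spec_tilde[OF assms(2)]
  note op = openin_Spec_tilde_iff_down_closed[OF assms(2)]
  \<comment> \<open>Rewriting with this equivalence brings the goal into the shape of the general
    compactness criterion.\<close>
  have prime_iff: "prime_submodule R M P \<longleftrightarrow> P \<in> topspace ?X" for P
    by (simp add: top Spec_module_def)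
  show ?thesis
    unfolding prime_iff
  proof (rule compact_space_iff_smallest_neighbourhoods)
    \<comment> \<open>The three conditions come from transitivity of inclusion, its reflexivity, and
      the downward closure of open sets.\<close>
    show "openin ?X (?N P)" for P
      unfolding op D_tilde_compl_colon by blast
    show "P \<in> ?N P" if "P \<in> topspace ?X" for P
      using that by (simp add: top D_tilde_compl_colon)
    show "?N P \<subseteq> U" if "openin ?X U" "P \<in> U" for P U
      using that unfolding op D_tilde_compl_colon by blast
  qed
qed

end
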